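(* Suppose the time-variation bounds (B i), (B ii), (B iii) described in the context hold, and that the pseudo-gradients are perfectly reconstructed, i.e. $\nabla_{x_i}\hat g_{i,t-1}(\boldsymbol{x}^\star_{t-1};t-1)=\nabla_{x_i}g_i(\boldsymbol{x}^\star_{t-1};t-1)$ for all $i\in\mathcal{I}$ and all $t$. Let $c(t)\ge2\ell$ and $\xi(t)\in[0,1/c(t))$ for all $t\in\mathbb{N}$. Fix some $T\in\mathbb{N}$, let $\mathcal{T}:=\{1,\ldots,T\}$ and, for any global minimizer $\boldsymbol{x}^\star(0)\in\Theta(0)$ of $\theta(\cdot;0)$ over $\Omega$, let $\Delta_0:=|\theta(\boldsymbol{x}^\star_0;0)-\theta(\boldsymbol{x}^\star(0);0)|$. Then the sequence $(\boldsymbol{x}^\star_t)_{t\in\mathcal{T}}$ of variational generalized Nash equilibria generated by the algorithm with the personalized incentives described in the context satisfies $$\frac1T\sum_{t\in\mathcal{T}}\|\Delta^\star_t\|\le\frac{\mathrm{e}_\nabla}{T\underline{\beta}}\sum_{t\in\mathcal{T}}\frac{1}{2\alpha(t)}+\frac{1}{T\underline{\beta}}\sqrt{\sum_{t\in\mathcal{T}}\left(\beta(t)\left(\Delta_0+T\phi\right)+\frac{\bar\beta}{4\alpha^2(t)\beta(t)}\,\mathrm{e}_\nabla^2\right)},$$ with $\underline{\beta}:=\min_{t\in\mathcal{T}}\beta(t)$, $\phi:=2\mathrm{e}_\theta+\tfrac{\ell}{2}\mathrm{e}_\delta^2$ and $\bar\beta:=\sum_{t\in\mathcal{T}}\bet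a(t)$.
   Context: Setting (time-varying game). There are $N$ agents indexed by $\mathcal{I}=\{1,\ldots,N\}$; agent $i$ controls $x_i\in\mathcal{X}_i\subseteq\mathbb{R}^{n_i}$, $n=\sum_i n_i$, $\boldsymbol{x}=(x_1,\ldots,x_N)=(x_i,\boldsymbol{x}_{-i})\in\mathbb{R}^n$, $\mathcal{X}=\prod_i\mathcal{X}_i$. At each discrete time $t\in\mathbb{N}$ agent $i$ minimizes its private cost $g_i(x_i,\boldsymbol{x}_{-i};t)$, $g_i:\mathbb{R}^n\times\mathbb{N}\to\mathbb{R}$, over $x_i\in\mathcal{X}_i$ subject to $h(\boldsymbol{x}):=\sum_jh_j(x_j)\le0$, $h_j:\mathbb{R}^{n_j}\to\mathbb{R}^m$. The feasible set is $\Omega:=\{\boldsymbol{x}\in\mathcal{X}:h(\boldsymbol{x})\le0\}$, and $G(\boldsymbol{x};t):=\mathrm{col}((\nabla_{x_i}g_i(x_i,\boldsymbol{x}_{-i};t))_{i\in\mathcal{I}})$. Standing assumptions. For all $t$: (1) each $g_i(\cdot;t)$ is continuously differentiable in $x_i$ and $\boldsymbol{x}\mapsto\nabla_{x_i}g_i(\boldsymbol{x};t)$ is $\ell_i$-Lipschitz; $\ell:=\sum_i\ell_i>0$. (2) Each $\mathcal{X}_i$ is nonempty, compact and convex, and each $h_i$ is convex (componentwise) and continuously differentiable. (3) The Jacobian of $G(\cdot;t)$ is symmetric at every point of $\Omega$; accordingly $\theta:\mathbb{R}^n\times\mathbb{N}\to\mathbb{R}$ is a function differentiable in $\boldsymbol{x}$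 (potential) with $G(\boldsymbol{x};t)=\nabla\theta(\boldsymbol{x};t)$ for $\boldsymbol{x}\in\Omega$. (4) The set $\Theta(t)$ of (local and global) minimizers of $\theta(\cdot;t)$ over $\Omega$ is nonempty. Algorithm. Given $\boldsymbol{x}^\star_0\in\Omega$, at each outer iteration $t\ge1$ a coordinator has an estimate $\hat G_{t-1}(\boldsymbol{x}^\star_{t-1};t-1)=\mathrm{col}((\nabla_{x_i}\hat g_{i,t-1}(\boldsymbol{x}^\star_{t-1};t-1))_i)$ of $G(\boldsymbol{x}^\star_{t-1};t-1)$, and issues the personalized incentives $u_i(\boldsymbol{x};t)=\tfrac12c(t)\|x_i-x_i^+(t)\|^2$, with $x_i^+(t):=x^\star_{i,t-1}+\xi(t)\nabla_{x_i}\hat g_{i,t-1}(\boldsymbol{x}^\star_{t-1};t-1)$ and parameters $c(t),\xi(t)\ge0$. The agents then compute a variational generalized Nash equilibrium $\boldsymbol{x}^\star_t$ of the game with costs $g_i(\cdot;t)+u_i(\cdot;t)$, i.e. $\boldsymbol{x}^\star_t\in\Omega$ with $(\boldsymbol{y}-\boldsymbol{x}^\star_t)^\top F(\boldsymbol{x}^\star_t;t)\ge0$ for all $\boldsymbol{y}\in\Omega$, where $F(\boldsymbol{x};t)=G(\boldsymbol{x};t)+c(t)\big(\boldsymbol{x}-\boldsymbol{x}^\star_{t-1}-\xi(t)\hat G_{t-1}(\boldsymbol{x}^\star_{t-1};t-1)\big)$. Define $\Delta^\star_t:=\boldsymbol{x}^\star_t-\boldsymbol{x}^\star_{t-1}$,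 $\alpha(t):=1-c(t)\xi(t)$, $\beta(t):=\frac{\ell(2-\alpha(t))}{2\alpha(t)}$. Time-variation bounds. For all $t\ge1$ and $\boldsymbol{x}\in\Omega$: (B i) $|\theta(\boldsymbol{x};t)-\theta(\boldsymbol{x};t-1)|\le\mathrm{e}_\theta$ with $0\le\mathrm{e}_\theta<\infty$; (B ii) for all $i$, $\|\nabla_{x_i}g_i(\boldsymbol{x};t)-\nabla_{x_i}g_i(\boldsymbol{x};t-1)\|\le\mathrm{e}_{\nabla_i}$ with $0\le\mathrm{e}_{\nabla_i}<\infty$; (B iii) $\|\boldsymbol{x}^\star(t)-\boldsymbol{x}^\star(t-1)\|\le\mathrm{e}_\delta$ with $0\le\mathrm{e}_\delta<\infty$, for consecutive minima $\boldsymbol{x}^\star(t)\in\Theta(t)$, $\boldsymbol{x}^\star(t-1)\in\Theta(t-1)$. Set $\mathrm{e}_\nabla:=\sum_{i\in\mathcal{I}}\mathrm{e}_{\nabla_i}$. *)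

theory Defs
  imports "HOL-Analysis.Analysis"
begin

text \<open>
  Encoding of the product of the agents' spaces: the coordinates of the joint decision vector
  are indexed by a finite type \<open>'n\<close>, and \<open>own k\<close> is the agent that controls coordinate \<open>k\<close>.
  The decision space of dimension \<open>n\<^sub>i\<close> of agent \<open>i\<close> is identified with the coordinate subspace
  \<open>agent_space own i\<close>, of dimension \<open>card {k. own k = i}\<close>; inner product and norm agree under this
  identification.
\<close>

definition agent_space :: "('n::finite \<Rightarrow> 'i) \<Rightarrow> 'i \<Rightarrow> (real^'n) set" where
  "agent_space own i = {x. \<forall>k. own k \<noteq> i \<longrightarrow> x $ k = 0}"

definition block :: "('n::finite \<Rightarrow> 'i) \<Rightarrow> 'i \<Rightarrow> real^'n \<Rightarrow> real^'n" where
  "block own i x = (\<chi> k. if own k = i then x $ k else 0)"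

text \<open>The profile \<open>(y\<^sub>i, x\<^sub>-\<^sub>i)\<close>:\<close>

definition with_block :: "('n::finite \<Rightarrow> 'i) \<Rightarrow> 'i \<Rightarrow> real^'n \<Rightarrow> real^'n \<Rightarrow> real^'n" where
  "with_block own i y x = (\<chi> k. if own k = i then y $ k else x $ k)"

definition gradient :: "('a::euclidean_space \<Rightarrow> real) \<Rightarrow> 'a \<Rightarrow> 'a" where
  "gradient f x = (THE D. GDERIV f x :> D)"

text \<open>
  The gradient in \<open>x\<^sub>i\<close>, as an element of \<open>agent_space own i\<close>: the function differentiated does not
  depend on the coordinates of the other agents, so the corresponding entries vanish.
\<close>

definition partial_gradient ::
    "('n::finite \<Rightarrow> 'i) \<Rightarrow> 'i \<Rightarrow> (real^'n \<Rightarrow> real) \<Rightarrow> real^'n \<Rightarrow> real^'n" where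
  "partial_gradient own i f x = gradient (\<lambda>y. f (with_block own i y x)) x"

text \<open>For costs \<open>J\<close>, the stacked vector of the gradients of \<open>J i\<close> in \<open>x\<^sub>i\<close>:\<close>

definition pseudo_gradient ::
    "('n::finite \<Rightarrow> 'i) \<Rightarrow> ('i \<Rightarrow> real^'n \<Rightarrow> real) \<Rightarrow> real^'n \<Rightarrow> real^'n" where
  "pseudo_gradient own J x = (\<chi> k. partial_gradient own (own k) (J (own k)) x $ k)"

definition continuously_differentiable ::
    "('a::real_normed_vector \<Rightarrow> 'b::real_normed_vector) \<Rightarrow> bool" where
  "continuously_differentiable f \<longleftrightarrow>
     (\<exists>f'. (\<forall>x. (f has_derivative blinfun_apply (f' x)) (at x)) \<and> continuous_on UNIV f')"

text \<open>
  Only the values of \<open>h j\<close> on \<open>agent_space own j\<close> matter; the order on \<^typ>\<open>real^'m\<close> is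
  componentwise.
\<close>

definition feasible_set ::
    "('n::finite \<Rightarrow> 'i::finite) \<Rightarrow> ('i \<Rightarrow> (real^'n) set) \<Rightarrow> ('i \<Rightarrow> real^'n \<Rightarrow> real^'m) \<Rightarrow> (real^'n) set"
  where
  "feasible_set own X h =
     {x. (\<forall>i. block own i x \<in> X i) \<and> (\<Sum>j\<in>UNIV. h j (block own j x)) \<le> 0}"

definition global_minimizers :: "'a set \<Rightarrow> ('a \<Rightarrow> real) \<Rightarrow> 'a set" where
  "global_minimizers S f = {x \<in> S. \<forall>y\<in>S. f x \<le> f y}"

definition local_minimizers :: "'a::metric_space set \<Rightarrow> ('a \<Rightarrow> real) \<Rightarrow> 'a set" where
  "local_minimizers S f = {x \<in> S. \<exists>r>0. \<forall>y\<in>S. dist y x < r \<longrightarrow> f x \<le> f y}"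

definition minimizers :: "'a::metric_space set \<Rightarrow> ('a \<Rightarrow> real) \<Rightarrow> 'a set" where
  "minimizers S f = local_minimizers S f \<union> global_minimizers S f"

text \<open>Variational generalized Nash equilibria of the game with costs \<open>J\<close> and feasible set \<open>S\<close>:\<close>

definition is_vGNE ::
    "('n::finite \<Rightarrow> 'i) \<Rightarrow> (real^'n) set \<Rightarrow> ('i \<Rightarrow> real^'n \<Rightarrow> real) \<Rightarrow> real^'n \<Rightarrow> bool" where
  "is_vGNE own S J x \<longleftrightarrow> x \<in> S \<and> (\<forall>y\<in>S. (y - x) \<bullet> pseudo_gradient own J x \<ge> 0)"

text \<open>
  \<open>xs t\<close> is the equilibrium computed at iteration \<open>t\<close>, and \<open>ghat i s t\<close> is the estimate, available
  at iteration \<open>s\<close>, of the cost of agent \<open>i\<close> at time \<open>t\<close>. The next two definitions are used for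
  \<open>t \<ge> 1\<close> only.
\<close>

definition incentive_center ::
    "('n::finite \<Rightarrow> 'i) \<Rightarrow> ('i \<Rightarrow> nat \<Rightarrow> nat \<Rightarrow> real^'n \<Rightarrow> real) \<Rightarrow> (nat \<Rightarrow> real^'n) \<Rightarrow> (nat \<Rightarrow> real)
       \<Rightarrow> 'i \<Rightarrow> nat \<Rightarrow> real^'n" where
  "incentive_center own ghat xs \<xi> i t =
     block own i (xs (t - 1))
       + \<xi> t *\<^sub>R partial_gradient own i (ghat i (t - 1) (t - 1)) (xs (t - 1))"

definition incentive ::
    "('n::finite \<Rightarrow> 'i) \<Rightarrow> ('i \<Rightarrow> nat \<Rightarrow> nat \<Rightarrow> real^'n \<Rightarrow> real) \<Rightarrow> (nat \<Rightarrow> real^'n) \<Rightarrow> (nat \<Rightarrow> real)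
       \<Rightarrow> (nat \<Rightarrow> real) \<Rightarrow> 'i \<Rightarrow> nat \<Rightarrow> real^'n \<Rightarrow> real" where
  "incentive own ghat xs c \<xi> i t x =
     1/2 * c t * (norm (block own i x - incentive_center own ghat xs \<xi> i t))\<^sup>2"

definition alpha :: "(nat \<Rightarrow> real) \<Rightarrow> (nat \<Rightarrow> real) \<Rightarrow> nat \<Rightarrow> real" where
  "alpha c \<xi> t = 1 - c t * \<xi> t"

definition beta :: "real \<Rightarrow> (nat \<Rightarrow> real) \<Rightarrow> (nat \<Rightarrow> real) \<Rightarrow> nat \<Rightarrow> real" where
  "beta l c \<xi> t = l * (2 - alpha c \<xi> t) / (2 * alpha c \<xi> t)"

lemma gradient_eq:
  assumes "GDERIV f x :> D"
  shows "gradient f x = D"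
proof -
  have "E = D" if "GDERIV f x :> E" for E
  proof -
    have "(\<lambda>h. h \<bullet> E) = (\<lambda>h. h \<bullet> D)"
      using that assms unfolding gderiv_def by (rule has_derivative_unique)
    then have "\<forall>h. h \<bullet> E = h \<bullet> D" by (simp add: fun_eq_iff)
    then show ?thesis by (simp only: vector_eq_ldot)
  qed
  with assms show ?thesis unfolding gradient_def by (rule the_equality)
qed

lemma GDERIV_gradient:
  fixes f :: "'a::euclidean_space \<Rightarrow> real"
  assumes "f differentiable (at x)"
  shows "GDERIV f x :> gradient f x"
proof -
  obtain f' where f': "(f has_derivative f') (at x)"
    using assms differentiable_def by blast
  then interpret bounded_linear f' by (rule has_derivative_bounded_linear)
  have "f' h = h \<bullet> (\<Sum>b\<in>Basis. f' b *\<^sub>R b)" for h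
  proof -
    have "f' h = f' (\<Sum>b\<in>Basis. (h \<bullet> b) *\<^sub>R b)"
      by (simp add: euclidean_representation)
    also have "\<dots> = (\<Sum>b\<in>Basis. (h \<bullet> b) * f' b)"
      by (simp add: sum scaleR)
    finally show ?thesis by (simp add: inner_sum_right mult.commute)
  qed
  then have "GDERIV f x :> (\<Sum>b\<in>Basis. f' b *\<^sub>R b)"
    unfolding gderiv_def by (intro has_derivative_eq_rhs[OF f'] ext)
  from this gradient_eq[OF this] show ?thesis by simp
qed

text \<open>The pseudo-gradient of the game with incentives, in closed form:\<close>

lemma pseudo_gradient_incentive:
  fixes own :: "'n::finite \<Rightarrow> 'i"
  assumes "\<And>i. (\<lambda>y. J i (with_block own i y x)) differentiable (at x)"
  shows "pseudo_gradient own (\<lambda>i y. J i y + incentive own ghat xs c \<xi> i t y) x =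
         pseudo_gradient own J x
           + c t *\<^sub>R (x - xs (t - 1)
               - \<xi> t *\<^sub>R pseudo_gradient own (\<lambda>i. ghat i (t - 1) (t - 1)) (xs (t - 1)))"
proof -
  have bl: "bounded_linear (block own i)" for i
    unfolding block_def
    by (rule linear_conv_bounded_linear[THEN iffD1], rule linearI) (simp_all add: vec_eq_iff)
  have pg: "partial_gradient own i (\<lambda>y. J i y + incentive own ghat xs c \<xi> i t y) x =
      partial_gradient own i (J i) x
        + c t *\<^sub>R block own i (block own i x - incentive_center own ghat xs \<xi> i t)" for i
  proof -
    define p where "p = incentive_center own ghat xs \<xi> i t"
    have 1: "GDERIV (\<lambda>y. J i (with_block own i y x)) x :> partial_gradient own i (J i) x"
      unfolding partial_gradient_def by (rule GDERIV_gradient) (rule assms)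
    have wb: "block own i (with_block own i y x) = block own i y" for y
      by (simp add: block_def with_block_def vec_eq_iff)
    have sa: "block own i a \<bullet> b = a \<bullet> block own i b" for a b
      unfolding block_def inner_vec_def by (intro sum.cong) auto
    have "((\<lambda>y. 1/2 * c t * ((block own i y - p) \<bullet> (block own i y - p))) has_derivative
        (\<lambda>h. 1/2 * c t * ((block own i x - p) \<bullet> block own i h + block own i h \<bullet> (block own i x - p)))) (at x)"
      using bounded_linear_imp_has_derivative[OF bl]
      by (auto intro!: derivative_eq_intros)
    then have 2: "GDERIV (\<lambda>y. incentive own ghat xs c \<xi> i t (with_block own i y x)) x :>
        c t *\<^sub>R block own i (block own i x - p)"
      unfolding gderiv_def incentive_def wb p_def[symmetric] power2_norm_eq_inner
      by (rule has_derivative_eq_rhs)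
         (simp add: fun_eq_iff inner_commute[of "block own i x - p"] sa)
    show ?thesis
      unfolding p_def[symmetric] using gradient_eq[OF GDERIV_add[OF 1 2]]
      by (simp add: partial_gradient_def)
  qed
  show ?thesis
    unfolding pseudo_gradient_def pg
    by (simp add: vec_eq_iff block_def incentive_center_def algebra_simps)
qed

end

theory Submission
  imports Defs
begin

text \<open>
  Testing the equilibrium condition at the previous iterate turns one round of the algorithm into a
  descent step for the potential. With \<open>\<Delta> = x\<^sub>t - x\<^sub>t\<^sub>-\<^sub>1\<close>, it reads
  \<open>\<Delta> \<bullet> (G\<^sub>t x\<^sub>t + c \<Delta> - (1 - \<alpha>) G\<^sub>t\<^sub>-\<^sub>1 x\<^sub>t\<^sub>-\<^sub>1) \<le> 0\<close>. Replacing both pseudo-gradients by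
  \<open>G\<^sub>t x\<^sub>t\<^sub>-\<^sub>1\<close> costs at most \<open>\<ell> \<parallel>\<Delta>\<parallel>\<^sup>2\<close> (Lipschitz continuity) and \<open>(1 - \<alpha>) e\<^sub>\<nabla> \<parallel>\<Delta>\<parallel>\<close> (slow
  variation), which leaves an upper bound on \<open>\<alpha> \<Delta> \<bullet> G\<^sub>t x\<^sub>t\<^sub>-\<^sub>1\<close>. The quadratic upper model of the
  potential along the segment from \<open>x\<^sub>t\<^sub>-\<^sub>1\<close> to \<open>x\<^sub>t\<close>, which lies in the convex set \<open>\<Omega>\<close>, then gives
  \<open>\<beta> \<parallel>\<Delta>\<parallel>\<^sup>2 - (e\<^sub>\<nabla> / \<alpha>) \<parallel>\<Delta>\<parallel> \<le> \<theta>\<^sub>t x\<^sub>t\<^sub>-\<^sub>1 - \<theta>\<^sub>t x\<^sub>t\<close> (lemma \<open>proximal_step_decrease\<close>); this is where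
  \<open>c \<ge> 2 \<ell>\<close> and the formula for \<open>\<beta>\<close> come from.

  The decreases add up to at most \<open>\<Delta>\<^sub>0 + 2 T e\<^sub>\<theta>\<close> (lemma \<open>drifting_decrease_sum_le\<close>): each change of
  the index \<open>t\<close> costs \<open>e\<^sub>\<theta>\<close> along the trajectory, and returning from time \<open>T\<close> to time \<open>0\<close> at the
  final iterate, where the minimum of \<open>\<theta>\<^sub>0\<close> is a lower bound, costs another \<open>T e\<^sub>\<theta>\<close>.

  Completing the square in every summand bounds \<open>\<Sum> \<beta> (\<parallel>\<Delta>\<parallel> - e\<^sub>\<nabla> / (2 \<alpha> \<beta>))\<^sup>2\<close>, and the
  Cauchy-Schwarz inequality with weights \<open>\<beta>\<close> turns this into a bound on \<open>\<Sum> \<beta> \<parallel>\<Delta>\<parallel>\<close> (lemma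
  \<open>weighted_sum_le_of_quadratic\<close>), which dominates \<open>\<beta>\<^sub>m\<^sub>i\<^sub>n \<Sum> \<parallel>\<Delta>\<parallel>\<close>.
\<close>

section \<open>Blocks, pseudo-gradients and the feasible set\<close>

lemma linear_block: "linear (block own i)"
  unfolding block_def by (rule linearI) (simp_all add: vec_eq_iff)

lemma norm_block_le: "norm (block own i x) \<le> norm x"
  by (rule norm_le_componentwise_cart) (simp add: block_def)

lemma block_in_agent_space: "block own i x \<in> agent_space own i"
  by (simp add: block_def agent_space_def)

lemma pseudo_gradient_eq_sum_block:
  fixes own :: "'n::finite \<Rightarrow> 'i::finite"
  shows "pseudo_gradient own J x = (\<Sum>i\<in>UNIV. block own i (partial_gradient own i (J i) x))"
  by (simp add: pseudo_gradient_def block_def vec_eq_iff)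

text \<open>
  The blocks of the individual gradients are projections of norm at most one, so bounds for the
  agents add up. This yields the Lipschitz constant \<open>\<Sum> \<ell>\<^sub>i\<close> as well as the drift bound
  \<open>\<Sum> e\<^sub>\<nabla>\<^sub>i\<close>.
\<close>

lemma norm_pseudo_gradient_diff_le:
  fixes own :: "'n::finite \<Rightarrow> 'i::finite"
  assumes "\<And>i. norm (partial_gradient own i (J i) x - partial_gradient own i (K i) y) \<le> b i"
  shows "norm (pseudo_gradient own J x - pseudo_gradient own K y) \<le> (\<Sum>i\<in>UNIV. b i)"
proof -
  have "pseudo_gradient own J x - pseudo_gradient own K y =
      (\<Sum>i\<in>UNIV. block own i (partial_gradient own i (J i) x - partial_gradient own i (K i) y))"
    by (simp add: pseudo_gradient_eq_sum_block sum_subtractf linear_diff[OF linear_block])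
  also have "norm \<dots> \<le> (\<Sum>i\<in>UNIV. b i)"
    by (rule sum_norm_le) (rule order_trans[OF norm_block_le assms])
  finally show ?thesis .
qed

lemma convex_feasible_set:
  fixes own :: "'n::finite \<Rightarrow> 'i::finite" and h :: "'i \<Rightarrow> real^'n \<Rightarrow> real^'m"
  assumes X: "\<And>i. convex (X i)"
    and h: "\<And>i j. convex_on (agent_space own i) (\<lambda>y. h i y $ j)"
  shows "convex (feasible_set own X h)"
proof (rule convexI)
  fix x y :: "real^'n" and u v :: real
  assume x: "x \<in> feasible_set own X h" and y: "y \<in> feasible_set own X h"
    and uv: "u \<ge> 0" "v \<ge> 0" "u + v = 1"
  have eq: "block own i (u *\<^sub>R x + v *\<^sub>R y) = u *\<^sub>R block own i x + v *\<^sub>R block own i y" for i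
    by (simp add: linear_add[OF linear_block] linear_cmul[OF linear_block])
  have "block own i (u *\<^sub>R x + v *\<^sub>R y) \<in> X i" for i
    using x y uv X[of i] unfolding eq by (auto simp: feasible_set_def intro: convexD)
  moreover have "(\<Sum>j\<in>UNIV. h j (block own j (u *\<^sub>R x + v *\<^sub>R y))) \<le> 0"
    unfolding less_eq_vec_def
  proof
    fix k
    have hx: "(\<Sum>j\<in>UNIV. h j (block own j x) $ k) \<le> 0"
      and hy: "(\<Sum>j\<in>UNIV. h j (block own j y) $ k) \<le> 0"
      using x y by (auto simp: feasible_set_def less_eq_vec_def)
    have "(\<Sum>j\<in>UNIV. h j (block own j (u *\<^sub>R x + v *\<^sub>R y)) $ k)
        \<le> (\<Sum>j\<in>UNIV. u * h j (block own j x) $ k + v * h j (block own j y) $ k)"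
      using h uv unfolding convex_on_def eq by (intro sum_mono) (simp add: block_in_agent_space)
    also have "\<dots> = u * (\<Sum>j\<in>UNIV. h j (block own j x) $ k) + v * (\<Sum>j\<in>UNIV. h j (block own j y) $ k)"
      by (simp add: sum.distrib sum_distrib_left)
    also have "\<dots> \<le> 0"
      using uv hx hy by (simp add: add_nonpos_nonpos mult_nonneg_nonpos)
    finally show "(\<Sum>j\<in>UNIV. h j (block own j (u *\<^sub>R x + v *\<^sub>R y))) $ k \<le> 0 $ k"
      by simp
  qed
  ultimately show "u *\<^sub>R x + v *\<^sub>R y \<in> feasible_set own X h"
    by (simp add: feasible_set_def)
qed

section \<open>Decrease of the potential in one step\<close>

text \<open>
  On the segment, the function minus its quadratic model at \<open>x\<close> has nonpositive directional
  derivative, by the Cauchy-Schwarz inequality and the gradient estimate.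
\<close>

lemma quadratic_upper_model:
  fixes f :: "'a::real_inner \<Rightarrow> real"
  assumes deriv: "\<And>z. z \<in> closed_segment x y \<Longrightarrow> GDERIV f z :> G z"
    and lip: "\<And>z. z \<in> closed_segment x y \<Longrightarrow> norm (G z - G x) \<le> L * norm (z - x)"
  shows "f y \<le> f x + (y - x) \<bullet> G x + L / 2 * (norm (y - x))\<^sup>2"
proof -
  define d where "d = y - x"
  define p where "p s = f (x + s *\<^sub>R d) - s * (d \<bullet> G x) - L / 2 * s\<^sup>2 * (norm d)\<^sup>2" for s :: real
  have "p 1 \<le> p 0"
  proof (rule DERIV_nonpos_imp_nonincreasing[of 0 1 p])
    fix s :: real
    assume s: "0 \<le> s" "s \<le> 1"
    let ?z = "x + s *\<^sub>R d"
    have "?z = (1 - s) *\<^sub>R x + s *\<^sub>R y"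
      by (simp add: d_def algebra_simps)
    then have z: "?z \<in> closed_segment x y"
      using s unfolding closed_segment_def by blast
    have line: "((\<lambda>s. x + s *\<^sub>R d) has_derivative (\<lambda>r. r *\<^sub>R d)) (at s)"
      by (auto intro!: derivative_eq_intros)
    have "((\<lambda>s. f (x + s *\<^sub>R d)) has_derivative (\<lambda>r. (r *\<^sub>R d) \<bullet> G ?z)) (at s)"
      using has_derivative_compose[OF line deriv[OF z, unfolded gderiv_def]] .
    then have f: "((\<lambda>s. f (x + s *\<^sub>R d)) has_real_derivative d \<bullet> G ?z) (at s)"
      by (simp add: has_field_derivative_def mult.commute[of _ "d \<bullet> G ?z"])
    have "(p has_real_derivative d \<bullet> G ?z - d \<bullet> G x - L * s * (norm d)\<^sup>2) (at s)"
      unfolding p_def by (rule derivative_eq_intros f refl | simp)+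
    moreover have "d \<bullet> G ?z - d \<bullet> G x - L * s * (norm d)\<^sup>2 \<le> 0"
    proof -
      have "d \<bullet> (G ?z - G x) \<le> norm d * norm (G ?z - G x)"
        by (rule norm_cauchy_schwarz)
      also have "\<dots> \<le> norm d * (L * norm (s *\<^sub>R d))"
        using lip[OF z] by (simp add: mult_left_mono)
      also have "\<dots> = L * s * (norm d)\<^sup>2"
        using s by (simp add: power2_eq_square)
      finally show ?thesis by (simp add: inner_diff_right)
    qed
    ultimately show "\<exists>D. (p has_real_derivative D) (at s) \<and> D \<le> 0"
      by blast
  qed simp
  then show ?thesis
    by (simp add: p_def d_def)
qed

text \<open>
  Here \<open>x\<close> and \<open>x'\<close> are consecutive equilibria, \<open>G\<close> is the current pseudo-gradient and \<open>v\<close> is the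
  previous one at \<open>x\<close>. The hypothesis \<open>vi\<close> is the variational inequality for \<open>x'\<close> tested at \<open>x\<close>,
  with \<open>1 - a\<close> in place of \<open>c \<xi>\<close>. Since \<open>a\<close> multiplies the linear term of the quadratic model
  there, dividing by \<open>a\<close> produces both the factor \<open>e / a\<close> and the modulus
  \<open>(c - l) / a - l / 2 \<ge> l / a - l / 2\<close>.
\<close>

lemma proximal_step_decrease:
  fixes f :: "'a::real_inner \<Rightarrow> real"
  assumes deriv: "\<And>z. z \<in> closed_segment x x' \<Longrightarrow> GDERIV f z :> G z"
    and lip: "\<And>z. z \<in> closed_segment x x' \<Longrightarrow> norm (G z - G x) \<le> l * norm (z - x)"
    and drift: "norm (v - G x) \<le> e"
    and vi: "(x' - x) \<bullet> (G x' + c *\<^sub>R (x' - x) - (1 - a) *\<^sub>R v) \<le> 0"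
    and a: "0 < a" "a \<le> 1" and c: "2 * l \<le> c"
  shows "l * (2 - a) / (2 * a) * (norm (x' - x))\<^sup>2 - e / a * norm (x' - x) \<le> f x - f x'"
proof -
  define d n where "d = x' - x" and "n = norm d"
  have e: "0 \<le> e" and n: "0 \<le> n"
    using drift norm_ge_zero order_trans by (blast, simp add: n_def)
  have "- (d \<bullet> (G x' - G x)) \<le> n * norm (G x' - G x)"
    using Cauchy_Schwarz_ineq2[of d "G x' - G x"] by (simp add: n_def abs_le_iff)
  also have "\<dots> \<le> n * (l * n)"
    using lip[of x'] n by (simp add: n_def d_def mult_left_mono)
  finally have lip': "- (d \<bullet> (G x' - G x)) \<le> l * n\<^sup>2"
    by (simp add: power2_eq_square mult.left_commute)
  have "d \<bullet> (v - G x) \<le> n * norm (v - G x)"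
    unfolding n_def by (rule norm_cauchy_schwarz)
  also have "\<dots> \<le> e * n"
    using drift n by (simp add: mult_left_mono mult.commute[of e])
  finally have "(1 - a) * (d \<bullet> (v - G x)) \<le> (1 - a) * (e * n)"
    using a by (simp add: mult_left_mono)
  also have "\<dots> \<le> e * n"
    using a e n by (simp add: mult_left_le_one_le)
  finally have drift': "(1 - a) * (d \<bullet> (v - G x)) \<le> e * n" .
  have "a * (d \<bullet> G x) = d \<bullet> (G x' + c *\<^sub>R d - (1 - a) *\<^sub>R v) - c * n\<^sup>2
      - d \<bullet> (G x' - G x) + (1 - a) * (d \<bullet> (v - G x))"
    by (simp add: n_def power2_norm_eq_inner inner_simps algebra_simps)
  also have "\<dots> \<le> - (l * n\<^sup>2) + e * n"
    using vi lip' drift' mult_right_mono[OF c, of "n\<^sup>2"] by (simp add: d_def)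
  finally have "d \<bullet> G x \<le> (- (l * n\<^sup>2) + e * n) / a"
    using a by (simp add: pos_le_divide_eq mult.commute)
  moreover have "f x' \<le> f x + d \<bullet> G x + l / 2 * n\<^sup>2"
    using quadratic_upper_model[OF deriv lip] by (simp add: d_def n_def)
  ultimately have "- ((- (l * n\<^sup>2) + e * n) / a) - l / 2 * n\<^sup>2 \<le> f x - f x'"
    by linarith
  moreover have "l * (2 - a) / (2 * a) * n\<^sup>2 - e / a * n
      = - ((- (l * n\<^sup>2) + e * n) / a) - l / 2 * n\<^sup>2"
    using a by (simp add: field_simps)
  ultimately show ?thesis
    by (simp only: n_def d_def)
qed

section \<open>Summation over the rounds\<close>

lemma drifting_decrease_sum_le:
  fixes \<theta> :: "nat \<Rightarrow> 'a \<Rightarrow> real"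
  assumes drift: "\<And>t x. t \<ge> 1 \<Longrightarrow> x \<in> S \<Longrightarrow> \<bar>\<theta> t x - \<theta> (t - 1) x\<bar> \<le> e"
    and x: "\<And>t. x t \<in> S" and m: "\<And>y. y \<in> S \<Longrightarrow> m \<le> \<theta> 0 y"
  shows "(\<Sum>t\<in>{1..T}. \<theta> t (x (t - 1)) - \<theta> t (x t)) \<le> \<theta> 0 (x 0) - m + 2 * real T * e"
proof -
  have along: "(\<Sum>t\<in>{1..n}. \<theta> t (x (t - 1)) - \<theta> t (x t)) \<le> \<theta> 0 (x 0) - \<theta> n (x n) + real n * e"
    for n
  proof (induction n)
    case (Suc n)
    then show ?case
      using drift[of "Suc n" "x n"] x by (simp add: algebra_simps abs_le_iff)
  qed simp
  have to_start: "\<theta> 0 y \<le> \<theta> n y + real n * e" if "y \<in> S" for y n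
  proof (induction n)
    case (Suc n)
    then show ?case
      using drift[of "Suc n" y] that by (simp add: algebra_simps abs_le_iff)
  qed simp
  show ?thesis
    using along[of T] to_start[OF x, of T T] m[OF x, of T] by simp
qed

text \<open>
  The Cauchy-Schwarz inequality is applied to \<open>\<surd>b\<close> and \<open>\<surd>b (n - r / (2 b))\<close>: completing the
  square bounds the sum of the squares of the latter, and the shift \<open>r / (2 b)\<close> accounts for the
  first sum on the right.
\<close>

lemma weighted_sum_le_of_quadratic:
  fixes b r n :: "'t \<Rightarrow> real"
  assumes b: "\<And>t. t \<in> A \<Longrightarrow> 0 < b t"
    and quad: "(\<Sum>t\<in>A. b t * (n t)\<^sup>2 - r t * n t) \<le> K"
  shows "(\<Sum>t\<in>A. b t * n t)
    \<le> (\<Sum>t\<in>A. r t / 2) + sqrt ((\<Sum>t\<in>A. b t) * (K + (\<Sum>t\<in>A. (r t)\<^sup>2 / (4 * b t))))"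
proof -
  define w where "w t = n t - r t / (2 * b t)" for t
  have "(\<Sum>t\<in>A. b t * (w t)\<^sup>2) = (\<Sum>t\<in>A. (b t * (n t)\<^sup>2 - r t * n t) + (r t)\<^sup>2 / (4 * b t))"
  proof (rule sum.cong[OF refl])
    fix t assume "t \<in> A"
    then have "b t \<noteq> 0" using b by force
    then show "b t * (w t)\<^sup>2 = (b t * (n t)\<^sup>2 - r t * n t) + (r t)\<^sup>2 / (4 * b t)"
      by (simp add: w_def field_simps power2_eq_square)
  qed
  also have "\<dots> \<le> K + (\<Sum>t\<in>A. (r t)\<^sup>2 / (4 * b t))"
    using quad by (simp add: sum.distrib)
  finally have square: "(\<Sum>t\<in>A. b t * (w t)\<^sup>2) \<le> K + (\<Sum>t\<in>A. (r t)\<^sup>2 / (4 * b t))" .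
  have "(\<Sum>t\<in>A. b t * w t)\<^sup>2 = (\<Sum>t\<in>A. sqrt (b t) * (sqrt (b t) * w t))\<^sup>2"
    using b by (intro arg_cong[where f = "\<lambda>z. z\<^sup>2"] sum.cong) (auto simp: less_imp_le simp flip: mult.assoc)
  also have "\<dots> \<le> (\<Sum>t\<in>A. (sqrt (b t))\<^sup>2) * (\<Sum>t\<in>A. (sqrt (b t) * w t)\<^sup>2)"
    by (rule Cauchy_Schwarz_ineq_sum)
  also have "\<dots> = (\<Sum>t\<in>A. b t) * (\<Sum>t\<in>A. b t * (w t)\<^sup>2)"
    using b by (simp add: power_mult_distrib less_imp_le)
  also have "\<dots> \<le> (\<Sum>t\<in>A. b t) * (K + (\<Sum>t\<in>A. (r t)\<^sup>2 / (4 * b t)))"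
    using b by (intro mult_left_mono square sum_nonneg) (simp add: less_imp_le)
  finally have "(\<Sum>t\<in>A. b t * w t)
      \<le> sqrt ((\<Sum>t\<in>A. b t) * (K + (\<Sum>t\<in>A. (r t)\<^sup>2 / (4 * b t))))"
    by (rule real_le_rsqrt)
  moreover have "(\<Sum>t\<in>A. b t * n t) = (\<Sum>t\<in>A. r t / 2) + (\<Sum>t\<in>A. b t * w t)"
    unfolding sum.distrib[symmetric]
  proof (rule sum.cong[OF refl])
    fix t assume "t \<in> A"
    then have "b t \<noteq> 0" using b by force
    then show "b t * n t = r t / 2 + b t * w t"
      by (simp add: w_def field_simps)
  qed
  ultimately show ?thesis by simp
qed

section \<open>Bound on the average step length\<close>

theorem theorem2:
  fixes own :: "'n::finite \<Rightarrow> 'i::finite"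
    and X :: "'i \<Rightarrow> (real^'n) set"
    and h :: "'i \<Rightarrow> real^'n \<Rightarrow> real^'m"
    and g :: "'i \<Rightarrow> nat \<Rightarrow> real^'n \<Rightarrow> real"
    and ghat :: "'i \<Rightarrow> nat \<Rightarrow> nat \<Rightarrow> real^'n \<Rightarrow> real"
    and \<theta> :: "nat \<Rightarrow> real^'n \<Rightarrow> real"
    and \<Omega> :: "(real^'n) set"
    and G :: "nat \<Rightarrow> real^'n \<Rightarrow> real^'n"
    and li :: "'i \<Rightarrow> real" and l :: real
    and xs :: "nat \<Rightarrow> real^'n"
    and c \<xi> :: "nat \<Rightarrow> real"
    and e_theta e_delta e_nabla :: real and e_nabla_i :: "'i \<Rightarrow> real"
    and xmin0 :: "real^'n" and \<Delta>0 \<phi> \<beta>min \<beta>bar :: real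
    and T :: nat
  assumes Omega: "\<Omega> = feasible_set own X h"
    and G: "\<And>t. G t = pseudo_gradient own (\<lambda>i. g i t)"
    \<comment> \<open>standing assumptions\<close>
    and g_C1: "\<And>i t x. continuously_differentiable (\<lambda>y. g i t (with_block own i y x))"
    and g_lipschitz: "\<And>i t. lipschitz_on (li i) UNIV (partial_gradient own i (g i t))"
    and l: "l = (\<Sum>i\<in>UNIV. li i)" "l > 0"
    and X: "\<And>i. X i \<subseteq> agent_space own i" "\<And>i. X i \<noteq> {}" "\<And>i. compact (X i)" "\<And>i. convex (X i)"
    and h_convex: "\<And>i j. convex_on (agent_space own i) (\<lambda>y. h i y $ j)"
    and h_C1: "\<And>i. continuously_differentiable (\<lambda>y. h i (block own i y))"
    and jacobian_sym: "\<And>t x. x \<in> \<Omega> \<Longrightarrow> G t differentiable (at x) \<and>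
      transpose (jacobian (G t) (at x)) = jacobian (G t) (at x)"
    and \<theta>_diff: "\<And>t x. \<theta> t differentiable (at x)"
    and \<theta>_gradient: "\<And>t x. x \<in> \<Omega> \<Longrightarrow> G t x = gradient (\<theta> t) x"
    and minimizers_ex: "\<And>t. minimizers \<Omega> (\<theta> t) \<noteq> {}"
    \<comment> \<open>time-variation bounds\<close>
    and B1: "e_theta \<ge> 0"
      "\<And>t x. t \<ge> 1 \<Longrightarrow> x \<in> \<Omega> \<Longrightarrow> \<bar>\<theta> t x - \<theta> (t - 1) x\<bar> \<le> e_theta"
    and B2: "\<And>i. e_nabla_i i \<ge> 0"
      "\<And>i t x. t \<ge> 1 \<Longrightarrow> x \<in> \<Omega> \<Longrightarrow>
         norm (partial_gradient own i (g i t) x - partial_gradient own i (g i (t - 1)) x) \<le> e_nabla_i i"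
    and B3: "e_delta \<ge> 0"
      "\<And>t y z. t \<ge> 1 \<Longrightarrow> y \<in> minimizers \<Omega> (\<theta> t) \<Longrightarrow> z \<in> minimizers \<Omega> (\<theta> (t - 1)) \<Longrightarrow>
         norm (y - z) \<le> e_delta"
    and e_nabla: "e_nabla = (\<Sum>i\<in>UNIV. e_nabla_i i)"
    \<comment> \<open>algorithm\<close>
    and init: "xs 0 \<in> \<Omega>"
    and step: "\<And>t. t \<ge> 1 \<Longrightarrow>
      is_vGNE own \<Omega> (\<lambda>i x. g i t x + incentive own ghat xs c \<xi> i t x) (xs t)"
    and reconstruction: "\<And>i t. t \<ge> 1 \<Longrightarrow>
      partial_gradient own i (ghat i (t - 1) (t - 1)) (xs (t - 1)) =
      partial_gradient own i (g i (t - 1)) (xs (t - 1))"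
    and c: "\<And>t. c t \<ge> 2 * l"
    and \<xi>: "\<And>t. 0 \<le> \<xi> t" "\<And>t. \<xi> t < 1 / c t"
    and T: "T \<ge> 1"
    and xmin0: "xmin0 \<in> global_minimizers \<Omega> (\<theta> 0)"
    and \<Delta>0: "\<Delta>0 = \<bar>\<theta> 0 (xs 0) - \<theta> 0 xmin0\<bar>"
    and \<phi>: "\<phi> = 2 * e_theta + l / 2 * e_delta\<^sup>2"
    and \<beta>min: "\<beta>min = (MIN t\<in>{1..T}. beta l c \<xi> t)"
    and \<beta>bar: "\<beta>bar = (\<Sum>t\<in>{1..T}. beta l c \<xi> t)"
  shows "1 / real T * (\<Sum>t\<in>{1..T}. norm (xs t - xs (t - 1)))
    \<le> e_nabla / (real T * \<beta>min) * (\<Sum>t\<in>{1..T}. 1 / (2 * alpha c \<xi> t))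
      + 1 / (real T * \<beta>min) *
        sqrt (\<Sum>t\<in>{1..T}. beta l c \<xi> t * (\<Delta>0 + real T * \<phi>)
               + \<beta>bar / (4 * (alpha c \<xi> t)\<^sup>2 * beta l c \<xi> t) * e_nabla\<^sup>2)"
proof -
  let ?a = "alpha c \<xi>" and ?b = "beta l c \<xi>" and ?n = "\<lambda>t. norm (xs t - xs (t - 1))"
  have a: "0 < ?a t" "?a t \<le> 1" for t
  proof -
    have "0 < c t" using c[of t] l(2) by simp
    then show "0 < ?a t" "?a t \<le> 1"
      using \<xi>[of t] by (auto simp: alpha_def field_simps)
  qed
  have b: "0 < ?b t" for t
    using a[of t] l(2) by (simp add: beta_def)
  have xs: "xs t \<in> \<Omega>" for t
    using init step[of t] by (cases "t = 0") (auto simp: is_vGNE_def)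
  have convex: "convex \<Omega>"
    unfolding Omega by (rule convex_feasible_set[OF X(4) h_convex])
  have lip: "norm (G t y - G t x) \<le> l * norm (y - x)" for t x y
  proof -
    have "norm (G t y - G t x) \<le> (\<Sum>i\<in>UNIV. li i * norm (y - x))"
      unfolding G using lipschitz_onD[OF g_lipschitz]
      by (intro norm_pseudo_gradient_diff_le) (simp add: dist_norm)
    then show ?thesis by (simp add: l sum_distrib_right)
  qed
  have drift: "norm (G (t - 1) x - G t x) \<le> e_nabla" if "t \<ge> 1" "x \<in> \<Omega>" for t x
    unfolding G e_nabla using B2(2)[OF that]
    by (intro norm_pseudo_gradient_diff_le) (simp add: norm_minus_commute)
  have decrease: "?b t * (?n t)\<^sup>2 - e_nabla / ?a t * ?n t \<le> \<theta> t (xs (t - 1)) - \<theta> t (xs t)"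
    if t: "t \<ge> 1" for t
    unfolding beta_def
  proof (rule proximal_step_decrease[where G = "G t" and v = "G (t - 1) (xs (t - 1))" and c = "c t"])
    show "GDERIV (\<theta> t) z :> G t z" if "z \<in> closed_segment (xs (t - 1)) (xs t)" for z
    proof -
      have "z \<in> \<Omega>"
        using that closed_segment_subset[OF xs xs convex] by blast
      then show ?thesis
        using GDERIV_gradient[OF \<theta>_diff, of t z] \<theta>_gradient[of z t] by simp
    qed
    have "(\<lambda>y. g i t (with_block own i y (xs t))) differentiable (at (xs t))" for i
      using g_C1[of i t "xs t"] by (auto simp: continuously_differentiable_def differentiable_def)
    then have "pseudo_gradient own (\<lambda>i y. g i t y + incentive own ghat xs c \<xi> i t y) (xs t) =
        G t (xs t) + c t *\<^sub>R (xs t - xs (t - 1)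
          - \<xi> t *\<^sub>R pseudo_gradient own (\<lambda>i. ghat i (t - 1) (t - 1)) (xs (t - 1)))"
      unfolding G by (rule pseudo_gradient_incentive)
    also have "pseudo_gradient own (\<lambda>i. ghat i (t - 1) (t - 1)) (xs (t - 1)) = G (t - 1) (xs (t - 1))"
      using reconstruction[OF t] by (simp add: G pseudo_gradient_def)
    finally have "0 \<le> (xs (t - 1) - xs t) \<bullet> (G t (xs t)
        + c t *\<^sub>R (xs t - xs (t - 1) - \<xi> t *\<^sub>R G (t - 1) (xs (t - 1))))"
      using step[OF t] xs[of "t - 1"] by (auto simp: is_vGNE_def)
    then show "(xs t - xs (t - 1)) \<bullet> (G t (xs t) + c t *\<^sub>R (xs t - xs (t - 1))
        - (1 - ?a t) *\<^sub>R G (t - 1) (xs (t - 1))) \<le> 0"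
      by (simp add: alpha_def inner_simps algebra_simps)
  qed (use lip drift[OF t xs] a c in auto)
  define K where "K = \<Delta>0 + real T * \<phi>"
  have "(\<Sum>t\<in>{1..T}. ?b t * (?n t)\<^sup>2 - e_nabla / ?a t * ?n t)
      \<le> (\<Sum>t\<in>{1..T}. \<theta> t (xs (t - 1)) - \<theta> t (xs t))"
    by (rule sum_mono) (rule decrease, simp)
  also have "\<dots> \<le> \<theta> 0 (xs 0) - \<theta> 0 xmin0 + 2 * real T * e_theta"
    using B1(2) xs xmin0 unfolding global_minimizers_def by (intro drifting_decrease_sum_le) auto
  also have "\<dots> \<le> K"
  proof -
    have "real T * (2 * e_theta) \<le> real T * \<phi>"
      using l(2) by (intro mult_left_mono) (simp_all add: \<phi>)
    then show ?thesis
      by (simp add: K_def \<Delta>0)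
  qed
  finally have quad: "(\<Sum>t\<in>{1..T}. ?b t * (?n t)\<^sup>2 - e_nabla / ?a t * ?n t) \<le> K" .
  define R where "R = (\<Sum>t\<in>{1..T}. ?b t * K + \<beta>bar / (4 * (?a t)\<^sup>2 * ?b t) * e_nabla\<^sup>2)"
  have min: "0 < \<beta>min" "\<And>t. t \<in> {1..T} \<Longrightarrow> \<beta>min \<le> ?b t"
    using b T unfolding \<beta>min by auto
  have "\<beta>min * (\<Sum>t\<in>{1..T}. ?n t) \<le> (\<Sum>t\<in>{1..T}. ?b t * ?n t)"
    unfolding sum_distrib_left using min(2) by (intro sum_mono mult_right_mono) auto
  also have "\<dots> \<le> (\<Sum>t\<in>{1..T}. e_nabla / ?a t / 2)
      + sqrt ((\<Sum>t\<in>{1..T}. ?b t) * (K + (\<Sum>t\<in>{1..T}. (e_nabla / ?a t)\<^sup>2 / (4 * ?b t))))"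
    by (rule weighted_sum_le_of_quadratic[OF b quad])
  also have "(\<Sum>t\<in>{1..T}. ?b t) * (K + (\<Sum>t\<in>{1..T}. (e_nabla / ?a t)\<^sup>2 / (4 * ?b t))) = R"
    by (simp add: R_def \<beta>bar sum.distrib sum_distrib_left sum_distrib_right distrib_left
        power_divide mult_ac)
  also have "(\<Sum>t\<in>{1..T}. e_nabla / ?a t / 2) = e_nabla * (\<Sum>t\<in>{1..T}. 1 / (2 * ?a t))"
    by (simp add: sum_distrib_left mult.commute)
  finally have "(\<Sum>t\<in>{1..T}. ?n t) \<le> (e_nabla * (\<Sum>t\<in>{1..T}. 1 / (2 * ?a t)) + sqrt R) / \<beta>min"
    using min(1) by (simp add: pos_le_divide_eq mult.commute)
  then have "1 / real T * (\<Sum>t\<in>{1..T}. ?n t)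
      \<le> 1 / real T * ((e_nabla * (\<Sum>t\<in>{1..T}. 1 / (2 * ?a t)) + sqrt R) / \<beta>min)"
    by (rule mult_left_mono) simp
  then show ?thesis
    unfolding K_def[symmetric] R_def[symmetric] by (simp add: add_divide_distrib mult.commute)
qed

end
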